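(* Let $a_{\max}\ge a_{\min}>0$ and let $\Gamma_1,\Gamma_2>0$ satisfy $\Gamma_1\le\frac{a_{\min}}{4a_{\max}^2}$ and $\Gamma_2\ge\frac1{a_{\min}}$. Let $x_c\in\mathbb{R}^n$ be a point with $\theta(x_c)<-\sigma_k$ for which the search direction is the Barzilai-Borwein type direction $$v_D(x_c)=v_a(x_c)=\operatorname{argmin}_{d\in\mathbb{R}^n}\max_{j=1,\ldots,m}\frac{\nabla f_j(x_c)^\top d}{a_j}+\frac12\|d\|^2,$$ with $a_{\min}\le a_j\le a_{\max}$ for all $j=1,\ldots,m$. Then $v_D(x_c)$ always passes the tests of the Front Descent algorithm, that is, $$\mathcal{D}(x_c,v_a(x_c))\le-\Gamma_1\|v(x_c)\|^2\quad\text{and}\quad\|v_a(x_c)\|\le\Gamma_2\|v(x_c)\|.$$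
   Context: $F=(f_1,\ldots,f_m)^\top:\mathbb{R}^n\to\mathbb{R}^m$ is continuously differentiable. $\mathcal{D}(x,d)=\max_{j=1,\ldots,m}\nabla f_j(x)^\top d$. $\theta(x)=\min_{d\in\mathbb{R}^n}\max_{j=1,\ldots,m}\nabla f_j(x)^\top d+\frac12\|d\|^2$, and $v(x)$ is the unique minimizer (the steepest common descent direction). In the Front Descent algorithm, with parameters $\Gamma_1,\Gamma_2>0$ and thresholds $\sigma_k\ge0$, at iteration $k$ a tentative direction $v_D(x_c)$ is computed at each processed point $x_c$ with $\theta(x_c)<-\sigma_k$, and it is used as search direction if and only if the two displayed inequalities (the "tests") hold; otherwise $v(x_c)$ is used. *)

theory Defs
  imports "HOL-Analysis.Analysis"
begin

definition continuously_differentiable ::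
    "('a::real_normed_vector \<Rightarrow> 'b::real_normed_vector) \<Rightarrow> bool" where
  "continuously_differentiable F \<longleftrightarrow>
     (\<exists>F' :: 'a \<Rightarrow> 'a \<Rightarrow>\<^sub>L 'b.
        (\<forall>x. (F has_derivative blinfun_apply (F' x)) (at x)) \<and> continuous_on UNIV F')"

text \<open>The gradient is unique where it exists, and unspecified elsewhere.\<close>

definition grad :: "('a::real_inner \<Rightarrow> real) \<Rightarrow> 'a \<Rightarrow> 'a" where
  "grad f x = (THE g. GDERIV f x :> g)"

definition common_slope :: "(real^'n \<Rightarrow> real^'m) \<Rightarrow> real^'n \<Rightarrow> real^'n \<Rightarrow> real" where
  "common_slope F x d = (MAX j. grad (\<lambda>y. F y $ j) x \<bullet> d)"

text \<open>
  The objective below is continuous, strongly convex and coercive in \<open>d\<close>, so the infimum defining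
  \<open>steepest_value\<close> is an attained minimum, and each ARG_MIN below picks
  the unique minimizer.
\<close>

definition steepest_value :: "(real^'n \<Rightarrow> real^'m) \<Rightarrow> real^'n \<Rightarrow> real" where
  "steepest_value F x =
     (INF d. (MAX j. grad (\<lambda>y. F y $ j) x \<bullet> d) + 1/2 * (norm d)\<^sup>2)"

definition steepest_direction :: "(real^'n \<Rightarrow> real^'m) \<Rightarrow> real^'n \<Rightarrow> real^'n" where
  "steepest_direction F x =
     (ARG_MIN (\<lambda>d. (MAX j. grad (\<lambda>y. F y $ j) x \<bullet> d) + 1/2 * (norm d)\<^sup>2) d. True)"

definition bb_direction ::
    "(real^'n \<Rightarrow> real^'m) \<Rightarrow> real^'m \<Rightarrow> real^'n \<Rightarrow> real^'n" where
  "bb_direction F a x =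
     (ARG_MIN (\<lambda>d. (MAX j. (grad (\<lambda>y. F y $ j) x \<bullet> d) / a $ j) + 1/2 * (norm d)\<^sup>2) d. True)"

end

theory Submission
  imports Defs
begin

text \<open>
  If \<open>w\<close> minimizes \<open>p d + \<parallel>d\<parallel>\<^sup>2 / 2\<close> for a sublinear \<open>p\<close>, then
  \<open>p w = - \<parallel>w\<parallel>\<^sup>2\<close> and \<open>p d \<ge> - w \<bullet> d\<close> for every \<open>d\<close>. For \<open>v = v(x\<^sub>c)\<close> and
  \<open>w = v\<^sub>a(x\<^sub>c)\<close> the equality for \<open>w\<close> gives
  \<open>\<D>(x\<^sub>c, w) \<le> - a_min \<parallel>w\<parallel>\<^sup>2\<close>. Testing the inequality for \<open>v\<close> at \<open>w\<close> gives
  \<open>a_min \<parallel>w\<parallel> \<le> \<parallel>v\<parallel>\<close>, and testing the one for \<open>w\<close> at \<open>v\<close> gives \<open>\<parallel>v\<parallel> \<le> a_max \<parallel>w\<parallel>\<close>.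
\<close>

lemma continuous_on_MAX:
  fixes f :: "'i::finite \<Rightarrow> 'a::topological_space \<Rightarrow> real"
  assumes "\<And>i. continuous_on S (f i)"
  shows "continuous_on S (\<lambda>x. MAX i. f i x)"
proof -
  have "continuous_on S (\<lambda>x. MAX i\<in>I. f i x)" if "finite I" "I \<noteq> {}" for I :: "'i set"
    using that by (induction rule: finite_ne_induct) (simp_all add: assms continuous_on_max)
  then show ?thesis by simp
qed

lemma MAX_le_iff:
  fixes f :: "'i::finite \<Rightarrow> 'b::linorder"
  shows "(MAX i. f i) \<le> y \<longleftrightarrow> (\<forall>i. f i \<le> y)"
  by (subst Max_le_iff) auto

lemma le_MAX:
  fixes f :: "'i::finite \<Rightarrow> 'b::linorder"
  shows "f j \<le> (MAX i. f i)"
  by (rule Max_ge) auto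

text \<open>\<open>ARG_MIN\<close> is a choice operator, so attainment must come first. Compactness
  gives a minimizer on the ball of radius \<open>2 * norm (c j)\<close>, for any one index
  \<open>j\<close>; outside it, Cauchy-Schwarz gives \<open>q d\<close> \<ge> 0 =
  \<open>q 0\<close>.\<close>

lemma is_arg_min_MAX_inner:
  fixes c :: "'i::finite \<Rightarrow> 'a::euclidean_space"
  defines "q \<equiv> \<lambda>d. (MAX i. c i \<bullet> d) + 1/2 * (norm d)\<^sup>2"
  shows "is_arg_min q (\<lambda>_. True) (ARG_MIN q d. True)"
proof -
  fix j :: 'i
  have "continuous_on (cball 0 (2 * norm (c j))) q"
    unfolding q_def by (intro continuous_intros continuous_on_MAX)
  then obtain w where w: "\<And>d. norm d \<le> 2 * norm (c j) \<Longrightarrow> q w \<le> q d"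
    using continuous_attains_inf[of "cball 0 (2 * norm (c j))" q] by (auto simp: Ball_def)
  have "q w \<le> q d" for d
  proof (cases "norm d \<le> 2 * norm (c j)")
    case False
    have "q w \<le> q 0" by (rule w) simp
    also have "q 0 = 0" by (simp add: q_def)
    also have "0 \<le> norm d * (norm d / 2 - norm (c j))"
      using False by (intro mult_nonneg_nonneg) auto
    also have "\<dots> = - (norm (c j) * norm d) + 1/2 * (norm d)\<^sup>2"
      by (simp add: algebra_simps power2_eq_square)
    also have "\<dots> \<le> q d"
      unfolding q_def
      using Cauchy_Schwarz_ineq2[of "c j" d] le_MAX[of "\<lambda>i. c i \<bullet> d" j] by linarith
    finally show ?thesis .
  qed (rule w)
  then have "is_arg_min q (\<lambda>_. True) w" by (simp add: is_arg_min_linorder)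
  then show ?thesis unfolding arg_min_def by (rule someI)
qed

text \<open>First-order optimality without derivatives of \<open>p\<close>: compare \<open>w\<close>
  with a nearby point at parameter \<open>t\<close>, divide by \<open>t\<close> and let
  \<open>t\<close> tend to 0 from the right.\<close>

lemma arg_min_sublinear:
  fixes p :: "'a::real_inner \<Rightarrow> real"
  assumes add: "\<And>x y. p (x + y) \<le> p x + p y"
    and scale: "\<And>t x. t \<ge> 0 \<Longrightarrow> p (t *\<^sub>R x) = t * p x"
    and w: "is_arg_min (\<lambda>d. p d + 1/2 * (norm d)\<^sup>2) (\<lambda>_. True) w"
  shows "- (w \<bullet> d) \<le> p d" and "p w = - (norm w)\<^sup>2"
proof -
  have min: "p w + 1/2 * (norm w)\<^sup>2 \<le> p d + 1/2 * (norm d)\<^sup>2" for d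
    using w by (simp add: is_arg_min_linorder)
  have limit: "0 \<le> A" if "\<And>t::real. 0 < t \<Longrightarrow> t < 1 \<Longrightarrow> 0 \<le> t * (A + t * B)" for A B
  proof (rule tendsto_lowerbound)
    show "((\<lambda>t. A + t * B) \<longlongrightarrow> A) (at_right 0)" by (auto intro!: tendsto_eq_intros)
    show "\<forall>\<^sub>F t in at_right 0. 0 \<le> A + t * B"
      unfolding eventually_at_right_field
      by (rule exI[of _ 1]) (use that in \<open>auto simp: zero_le_mult_iff\<close>)
  qed simp
  have lower: "- (w \<bullet> d) \<le> p d" for d
  proof -
    have "0 \<le> p d + w \<bullet> d"
    proof (rule limit)
      fix t :: real assume "0 < t" "t < 1"
      then have "p (w + t *\<^sub>R d) \<le> p w + t * p d" using add[of w "t *\<^sub>R d"] scale[of t d] by simp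
      then show "0 \<le> t * (p d + w \<bullet> d + t * ((norm d)\<^sup>2 / 2))"
        using min[of "w + t *\<^sub>R d"]
        by (simp add: power2_norm_eq_inner inner_add inner_commute algebra_simps)
    qed
    then show ?thesis by simp
  qed
  then show "- (w \<bullet> d) \<le> p d" .
  \<comment> \<open>Shrinking \<open>w\<close> to \<open>(1 - t) *\<^sub>R w\<close> keeps the
    factor nonnegative, so \<open>scale\<close> applies. This bounds \<open>p w\<close> from above;
    \<open>lower\<close> at \<open>w\<close> is the converse.\<close>
  have "0 \<le> - p w - (norm w)\<^sup>2"
  proof (rule limit)
    fix t :: real assume "0 < t" "t < 1"
    then have "p w + 1/2 * (norm w)\<^sup>2 \<le> (1 - t) * p w + 1/2 * ((1 - t)\<^sup>2 * (norm w)\<^sup>2)"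
      using min[of "(1 - t) *\<^sub>R w"] scale[of "1 - t" w] by (simp add: power_mult_distrib)
    then show "0 \<le> t * (- p w - (norm w)\<^sup>2 + t * ((norm w)\<^sup>2 / 2))"
      by (simp add: power2_eq_square algebra_simps)
  qed
  then show "p w = - (norm w)\<^sup>2" using lower[of w] by (simp add: power2_norm_eq_inner)
qed

text \<open>A maximum of finitely many linear forms is sublinear. Leaving \<open>c\<close> arbitrary
  lets the result serve both search directions.\<close>

lemma arg_min_MAX_inner:
  fixes c :: "'i::finite \<Rightarrow> 'a::euclidean_space"
  defines "w \<equiv> ARG_MIN (\<lambda>d. (MAX i. c i \<bullet> d) + 1/2 * (norm d)\<^sup>2) d. True"
  shows "- (w \<bullet> d) \<le> (MAX i. c i \<bullet> d)" and "(MAX i. c i \<bullet> w) = - (norm w)\<^sup>2"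
proof -
  let ?p = "\<lambda>d. MAX i. c i \<bullet> d"
  have add: "?p (x + y) \<le> ?p x + ?p y" for x y
    by (auto simp: MAX_le_iff inner_add_right intro!: add_mono le_MAX)
  have scale: "?p (t *\<^sub>R x) = t * ?p x" if "t \<ge> 0" for t x
    using mono_Max_commute[of "(*) t" "range (\<lambda>i. c i \<bullet> x)"] that
    by (simp add: image_image mono_def mult_left_mono)
  have w: "is_arg_min (\<lambda>d. ?p d + 1/2 * (norm d)\<^sup>2) (\<lambda>_. True) w"
    unfolding w_def by (rule is_arg_min_MAX_inner)
  show "- (w \<bullet> d) \<le> ?p d" "?p w = - (norm w)\<^sup>2"
    using arg_min_sublinear[of ?p, OF add scale w] by auto
qed

theorem proposition5p10:
  fixes F :: "real^'n \<Rightarrow> real^'m"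
    and a :: "real^'m"
    and a_min a_max \<Gamma>\<^sub>1 \<Gamma>\<^sub>2 :: real
    and \<sigma> :: "nat \<Rightarrow> real" and k :: nat
    and x\<^sub>c :: "real^'n"
    and v\<^sub>D :: "real^'n \<Rightarrow> real^'n"
  assumes "continuously_differentiable F"
    and "a_min > 0" and "a_max \<ge> a_min"
    and "\<Gamma>\<^sub>1 > 0" and "\<Gamma>\<^sub>2 > 0"
    and "\<Gamma>\<^sub>1 \<le> a_min / (4 * a_max\<^sup>2)"
    and "\<Gamma>\<^sub>2 \<ge> 1 / a_min"
    and "\<And>i. \<sigma> i \<ge> 0"
    and "steepest_value F x\<^sub>c < - \<sigma> k"
    and "\<And>j. a_min \<le> a $ j \<and> a $ j \<le> a_max"
    and "v\<^sub>D x\<^sub>c = bb_direction F a x\<^sub>c"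
  shows "common_slope F x\<^sub>c (v\<^sub>D x\<^sub>c) \<le> - \<Gamma>\<^sub>1 * (norm (steepest_direction F x\<^sub>c))\<^sup>2 \<and>
         norm (v\<^sub>D x\<^sub>c) \<le> \<Gamma>\<^sub>2 * norm (steepest_direction F x\<^sub>c)"
proof -
  define g where "g j = grad (\<lambda>y. F y $ j) x\<^sub>c" for j
  define v where "v = steepest_direction F x\<^sub>c"
  define w where "w = bb_direction F a x\<^sub>c"
  have a_bounds: "a_min \<le> a $ j" "a $ j \<le> a_max" for j using assms(10) by auto
  have a_pos: "a $ j > 0" for j using a_bounds(1)[of j] assms(2) by linarith
  have a_max_pos: "a_max > 0" using assms(2,3) by linarith
  \<comment> \<open>Moving the weight into the gradient turns the Barzilai-Borwein objective into
    one of the form already treated.\<close>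
  have inner_scaled: "(g j /\<^sub>R a $ j) \<bullet> d = (g j \<bullet> d) / a $ j" for j d
    by (simp add: divide_inverse)
  note v_props = arg_min_MAX_inner[of g,
      folded v_def[unfolded steepest_direction_def, folded g_def]]
  have w_eq: "w = (ARG_MIN (\<lambda>d. (MAX j. (g j /\<^sub>R a $ j) \<bullet> d) + 1/2 * (norm d)\<^sup>2) d. True)"
    unfolding inner_scaled by (simp only: w_def bb_direction_def g_def)
  note w_props = arg_min_MAX_inner[of "\<lambda>j. g j /\<^sub>R a $ j", folded w_eq, unfolded inner_scaled]
  have slope_w: "(MAX j. g j \<bullet> w) \<le> - (a_min * (norm w)\<^sup>2)"
    unfolding MAX_le_iff
  proof
    fix j
    have "(g j \<bullet> w) / a $ j \<le> - (norm w)\<^sup>2"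
      using le_MAX[of "\<lambda>j. (g j \<bullet> w) / a $ j" j] by (simp add: w_props(2))
    then have "g j \<bullet> w \<le> - (a $ j * (norm w)\<^sup>2)"
      using a_pos[of j] by (simp add: pos_divide_le_eq mult.commute)
    also have "\<dots> \<le> - (a_min * (norm w)\<^sup>2)" using a_bounds(1)[of j] by (simp add: mult_right_mono)
    finally show "g j \<bullet> w \<le> - (a_min * (norm w)\<^sup>2)" .
  qed
  \<comment> \<open>The numerators are at most \<open>- (norm v)\<^sup>2\<close>, which is
    nonpositive, so the weakest bound comes from the largest weight, hence
    \<open>a_max\<close>.\<close>
  have scaled_slope_v: "(MAX j. (g j \<bullet> v) / a $ j) \<le> - ((norm v)\<^sup>2 / a_max)"
    unfolding MAX_le_iff
  proof
    fix j
    have "g j \<bullet> v \<le> - (norm v)\<^sup>2"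
      using le_MAX[of "\<lambda>j. g j \<bullet> v" j] by (simp add: v_props(2))
    then have "(g j \<bullet> v) / a $ j \<le> - ((norm v)\<^sup>2 / a $ j)"
      using a_pos[of j] divide_right_mono[of "g j \<bullet> v" "- (norm v)\<^sup>2" "a $ j"] by simp
    also have "\<dots> \<le> - ((norm v)\<^sup>2 / a_max)"
      using a_pos[of j] a_bounds(2)[of j] by (simp add: divide_left_mono)
    finally show "(g j \<bullet> v) / a $ j \<le> - ((norm v)\<^sup>2 / a_max)" .
  qed
  have "a_min * (norm w)\<^sup>2 \<le> v \<bullet> w" using v_props(1)[of w] slope_w by linarith
  then have "a_min * norm w * norm w \<le> norm v * norm w"
    using norm_cauchy_schwarz[of v w] by (simp add: power2_eq_square mult.assoc)
  \<comment> \<open>The factor \<open>norm w\<close> cancels when nonzero; otherwise the left side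
    is 0.\<close>
  then have w_le: "a_min * norm w \<le> norm v"
    by (cases "norm w = 0") (auto simp: mult_le_cancel_right)
  have "(norm v)\<^sup>2 / a_max \<le> w \<bullet> v" using w_props(1)[of v] scaled_slope_v by linarith
  also have "\<dots> \<le> norm w * norm v" by (rule norm_cauchy_schwarz)
  finally have "norm v * norm v \<le> (a_max * norm w) * norm v"
    using a_max_pos by (simp add: pos_divide_le_eq power2_eq_square mult_ac)
  then have v_le: "norm v \<le> a_max * norm w"
    using a_max_pos by (cases "norm v = 0") (auto simp: mult_le_cancel_right)
  \<comment> \<open>By \<open>v_le\<close>, the squares of \<open>a_max\<close> cancel, leaving a
    quarter of the decrease in \<open>slope_w\<close>.\<close>
  have "\<Gamma>\<^sub>1 * (norm v)\<^sup>2 \<le> a_min / (4 * a_max\<^sup>2) * (a_max * norm w)\<^sup>2"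
    using assms(2,6) v_le by (intro mult_mono power_mono) auto
  also have "\<dots> = a_min * (norm w)\<^sup>2 / 4"
    using a_max_pos by (simp add: power_mult_distrib)
  also have "\<dots> \<le> a_min * (norm w)\<^sup>2" using assms(2) by simp
  finally have "(MAX j. g j \<bullet> w) \<le> - \<Gamma>\<^sub>1 * (norm v)\<^sup>2" using slope_w by linarith
  moreover have "norm w \<le> 1 / a_min * norm v"
    using w_le assms(2) by (simp add: pos_le_divide_eq mult.commute)
  then have "norm w \<le> \<Gamma>\<^sub>2 * norm v"
    using mult_right_mono[OF assms(7), of "norm v"] by simp
  ultimately show ?thesis
    by (simp add: assms(11) common_slope_def g_def v_def w_def)
qed

end
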